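(* For every integer $d\geq 1$ let $X$ be a random vector in $\mathbb{R}^d$ with $X\sim\mathcal{N}(0,1,\mathbb{R}^d)$. Then: (i) for all $d\geq 1$: $\bigl|\mathrm{E}\bigl(\|X\|-\sqrt{d}\bigr)\bigr|\leq \frac{1}{\sqrt{d}}$; (ii) for all $d\geq 1$: $\mathrm{V}(\|X\|)\leq 2$. In particular, $\mathrm{E}\bigl(\|X\|-\sqrt{d}\bigr)$ converges to zero as $d\to\infty$.
   Context: $\mathcal{N}(0,1,\mathbb{R}^d)$ denotes the spherical Gaussian distribution on $\mathbb{R}^d$ with mean zero and unit variance, i.e. with density $(2\pi)^{-d/2}\exp(-\|x\|^2/2)$ with respect to Lebesgue measure (equivalently, the coordinates are independent standard normal variables). $\|\cdot\|$ is the Euclidean norm, $\mathrm{E}$ the expectation and $\mathrm{V}$ the variance. *)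

theory Defs
  imports "HOL-Probability.Probability"
begin

text \<open>
  Since the dimension \<open>d\<close> tends to infinity in the theorem, it cannot be a type. Vectors of
  \<open>\<real>\<^sup>d\<close> are functions on the index set \<open>{..<d}\<close>, extensional as elements of the product space
  (value \<open>undefined\<close> outside \<open>{..<d}\<close>). The Euclidean norm is \<open>L2_set x {..<d}\<close>.
\<close>

definition lebesgue_Rn :: "nat \<Rightarrow> (nat \<Rightarrow> real) measure" where
  "lebesgue_Rn d = (\<Pi>\<^sub>M i\<in>{..<d}. lborel)"

definition norm_Rn :: "nat \<Rightarrow> (nat \<Rightarrow> real) \<Rightarrow> real" where
  "norm_Rn d x = L2_set x {..<d}"

definition spherical_gaussian_density :: "nat \<Rightarrow> (nat \<Rightarrow> real) \<Rightarrow> real" where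
  "spherical_gaussian_density d x =
     (2 * pi) powr (- real d / 2) * exp (- (norm_Rn d x)\<^sup>2 / 2)"

definition spherical_gaussian :: "'a measure \<Rightarrow> nat \<Rightarrow> ('a \<Rightarrow> nat \<Rightarrow> real) \<Rightarrow> bool" where
  "spherical_gaussian M d X \<longleftrightarrow>
     distributed M (lebesgue_Rn d) X (\<lambda>x. ennreal (spherical_gaussian_density d x))"

end

theory Submission
  imports Defs
begin

text \<open>
  The squared norm \<open>S = \<parallel>X\<parallel>\<^sup>2\<close> is a sum of \<open>d\<close> independent squares of standard normal variables, so
  it has mean \<open>d\<close> and variance \<open>2 * d\<close>. Write \<open>N = \<parallel>X\<parallel>\<close> and \<open>c = sqrt d\<close>. Both claims follow from
  the single factorisation \<open>N\<^sup>2 - c\<^sup>2 = (N - c) * (N + c)\<close>.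

  Since \<open>N + c \<ge> c\<close>, it gives \<open>(N - c)\<^sup>2 \<le> (S - d)\<^sup>2 / d\<close>, hence \<open>E (N - c)\<^sup>2 \<le> 2\<close>. The variance of \<open>N\<close> is
  the least mean square deviation from a constant, so it is at most \<open>2\<close> as well.

  Completing the square instead, \<open>S - d = (N - c)\<^sup>2 + 2 * c * (N - c)\<close>, and since the left-hand side
  has mean zero, \<open>E (N - c) = - E (N - c)\<^sup>2 / (2 * c)\<close>. The bound on the mean square deviation therefore
  also controls the bias, which is why the bias is of order \<open>1 / c\<close> rather than merely bounded.

  This second part, \<open>mean_and_variance_of_root\<close>, holds for any nonnegative random variable. The two
  moments of \<open>S\<close> come from \<open>gaussian_integral_prod\<close>: the density factorises over the coordinates,
  so the integral of a product of functions of single coordinates is the product of the integrals.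
\<close>

section \<open>From the moments of a square to its root\<close>

text \<open>
  Everything is measured by the mean square deviation of \<open>N\<close> from \<open>c\<close>, which is at most \<open>v / c\<^sup>2\<close>
  because \<open>(N - c)\<^sup>2 * c\<^sup>2 \<le> (N\<^sup>2 - c\<^sup>2)\<^sup>2\<close>. It bounds the variance, and it determines the bias exactly
  because \<open>N\<^sup>2 - c\<^sup>2\<close> has mean zero.
\<close>
lemma (in prob_space) mean_and_variance_of_root:
  fixes N :: "'a \<Rightarrow> real"
  assumes meas [measurable]: "N \<in> borel_measurable M"
    and nonneg: "\<And>\<omega>. 0 \<le> N \<omega>" and c: "0 < c"
    and mean: "has_bochner_integral M (\<lambda>\<omega>. (N \<omega>)\<^sup>2 - c\<^sup>2) 0"
    and var: "has_bochner_integral M (\<lambda>\<omega>. ((N \<omega>)\<^sup>2 - c\<^sup>2)\<^sup>2) v"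
  shows "integrable M N"
    and "integrable M (\<lambda>\<omega>. (N \<omega> - a)\<^sup>2)"
    and "\<bar>expectation (\<lambda>\<omega>. N \<omega> - c)\<bar> \<le> v / (2 * c ^ 3)"
    and "variance N \<le> v / c\<^sup>2"
proof -
  note mean' = mean[unfolded has_bochner_integral_iff]
    and var' = var[unfolded has_bochner_integral_iff]
  have sq: "integrable M (\<lambda>\<omega>. (N \<omega>)\<^sup>2)"
    using Bochner_Integration.integrable_add[OF conjunct1[OF mean'], of "\<lambda>_. c\<^sup>2"] by simp
  show N: "integrable M N"
    using square_integrable_imp_integrable[OF meas sq] .
  have dev: "integrable M (\<lambda>\<omega>. (N \<omega> - a)\<^sup>2)" for a
    unfolding power2_diff using sq N by simp
  then show "integrable M (\<lambda>\<omega>. (N \<omega> - a)\<^sup>2)" .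
  have pointwise: "(N \<omega> - c)\<^sup>2 \<le> ((N \<omega>)\<^sup>2 - c\<^sup>2)\<^sup>2 / c\<^sup>2" for \<omega>
  proof -
    have "(N \<omega> - c)\<^sup>2 * c\<^sup>2 \<le> (N \<omega> - c)\<^sup>2 * (N \<omega> + c)\<^sup>2"
      using nonneg[of \<omega>] c by (intro mult_left_mono power_mono) auto
    also have "\<dots> = ((N \<omega>)\<^sup>2 - c\<^sup>2)\<^sup>2"
      by (simp add: power2_eq_square algebra_simps)
    finally show ?thesis
      using c by (simp add: field_simps)
  qed
  have msd: "expectation (\<lambda>\<omega>. (N \<omega> - c)\<^sup>2) \<le> v / c\<^sup>2"
  proof -
    have "expectation (\<lambda>\<omega>. (N \<omega> - c)\<^sup>2) \<le> expectation (\<lambda>\<omega>. ((N \<omega>)\<^sup>2 - c\<^sup>2)\<^sup>2 / c\<^sup>2)"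
      using dev[of c] var' pointwise by (intro integral_mono) auto
    also have "\<dots> = v / c\<^sup>2"
      using var' by simp
    finally show ?thesis .
  qed
  (* Completing the square turns the vanishing mean of the square into an equation for the bias. *)
  have "0 = expectation (\<lambda>\<omega>. (N \<omega> - c)\<^sup>2 + 2 * c * (N \<omega> - c))"
    using mean' by (simp add: power2_eq_square algebra_simps)
  also have "\<dots> = expectation (\<lambda>\<omega>. (N \<omega> - c)\<^sup>2) + 2 * c * expectation (\<lambda>\<omega>. N \<omega> - c)"
    using dev[of c] N
    by (subst Bochner_Integration.integral_add) (auto simp del: Bochner_Integration.integral_diff)
  finally have bias: "expectation (\<lambda>\<omega>. N \<omega> - c) = - (expectation (\<lambda>\<omega>. (N \<omega> - c)\<^sup>2) / (2 * c))"
    using c by (simp add: field_simps)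
  have "\<bar>expectation (\<lambda>\<omega>. N \<omega> - c)\<bar> = expectation (\<lambda>\<omega>. (N \<omega> - c)\<^sup>2) / (2 * c)"
    unfolding bias using c by simp
  also have "\<dots> \<le> (v / c\<^sup>2) / (2 * c)"
    using msd c by (intro divide_right_mono) auto
  also have "\<dots> = v / (2 * c ^ 3)"
    by (simp add: power2_eq_square power3_eq_cube)
  finally show "\<bar>expectation (\<lambda>\<omega>. N \<omega> - c)\<bar> \<le> v / (2 * c ^ 3)" .
  have "variance N = expectation (\<lambda>\<omega>. (N \<omega> - c)\<^sup>2) - (expectation N - c)\<^sup>2"
    using sq N by (simp add: variance_eq power2_diff prob_space) (simp add: power2_eq_square)
  then show "variance N \<le> v / c\<^sup>2"
    using msd zero_le_power2[of "expectation N - c"] by linarith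
qed

section \<open>Moments of the squared norm\<close>

lemma spherical_gaussian_density_eq_prod:
  "spherical_gaussian_density d x = (\<Prod>i<d. std_normal_density (x i))"
proof -
  have "(2 * pi) powr (- real d / 2) = (1 / sqrt (2 * pi)) ^ d"
    by (subst powr_half_sqrt[symmetric])
      (simp_all add: powr_power powr_minus_divide power_one_over)
  moreover have "- (norm_Rn d x)\<^sup>2 / 2 = (\<Sum>i<d. - (x i)\<^sup>2 / 2)"
    by (simp add: norm_Rn_def L2_set_def sum_nonneg sum_negf sum_divide_distrib)
  ultimately show ?thesis
    by (simp only: spherical_gaussian_density_def std_normal_density_def prod.distrib exp_sum
        finite_lessThan prod_constant card_lessThan)
qed

text \<open>
  Independence of the coordinates in the form used below. It is read off the factorised density by
  Fubini, without passing through the distributions of the single coordinates.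
\<close>
lemma gaussian_integral_prod:
  fixes h :: "nat \<Rightarrow> real \<Rightarrow> real"
  assumes X: "spherical_gaussian M d X"
    and meas [measurable]: "\<And>i. h i \<in> borel_measurable borel"
    and h: "\<And>i. i < d \<Longrightarrow> has_bochner_integral lborel (\<lambda>t. std_normal_density t * h i t) (c i)"
  shows "has_bochner_integral M (\<lambda>\<omega>. \<Prod>i<d. h i (X \<omega> i)) (\<Prod>i<d. c i)"
proof -
  interpret product_sigma_finite "\<lambda>_::nat. lborel :: real measure"
    by standard
  let ?f = "spherical_gaussian_density d" and ?g = "\<lambda>x. \<Prod>i<d. h i (x i)"
  note D = X[unfolded spherical_gaussian_def]
  have g: "?g \<in> borel_measurable (lebesgue_Rn d)"
    unfolding lebesgue_Rn_def by measurable
  have nonneg: "0 \<le> ?f x" for x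
    by (simp add: spherical_gaussian_density_def)
  have fg: "?f x * ?g x = (\<Prod>i<d. std_normal_density (x i) * h i (x i))" for x
    by (simp add: spherical_gaussian_density_eq_prod prod.distrib)
  have "integrable (lebesgue_Rn d) (\<lambda>x. ?f x * ?g x)"
    unfolding fg lebesgue_Rn_def
    using h by (intro product_integrable_prod) (auto simp: has_bochner_integral_iff)
  moreover have "(\<integral>x. ?f x * ?g x \<partial>lebesgue_Rn d) = (\<Prod>i<d. c i)"
    unfolding fg lebesgue_Rn_def
    using h by (subst product_integral_prod) (auto simp: has_bochner_integral_iff intro!: prod.cong)
  ultimately show ?thesis
    using distributed_integrable[OF D g nonneg] distributed_integral[OF D g nonneg]
    by (simp add: has_bochner_integral_iff)
qed

lemma std_normal_centred_square_moments:
  shows "has_bochner_integral lborel (\<lambda>t. std_normal_density t * 1) 1"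
    and "has_bochner_integral lborel (\<lambda>t. std_normal_density t * (t\<^sup>2 - 1)) 0"
    and "has_bochner_integral lborel (\<lambda>t. std_normal_density t * ((t\<^sup>2 - 1) * (t\<^sup>2 - 1))) 2"
proof -
  have m0: "has_bochner_integral lborel (\<lambda>t. std_normal_density t) 1"
    using std_normal_moment_even[of 0] by simp
  have m2: "has_bochner_integral lborel (\<lambda>t. std_normal_density t * t\<^sup>2) 1"
    using std_normal_moment_even[of 1] by (simp add: numeral_2_eq_2)
  have m4: "has_bochner_integral lborel (\<lambda>t. std_normal_density t * t ^ 4) 3"
    using std_normal_moment_even[of 2] by (simp add: fact_numeral)
  show "has_bochner_integral lborel (\<lambda>t. std_normal_density t * 1) 1"
    using m0 by simp
  show "has_bochner_integral lborel (\<lambda>t. std_normal_density t * (t\<^sup>2 - 1)) 0"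
    using has_bochner_integral_diff[OF m2 m0] by (simp add: algebra_simps)
  have "std_normal_density t * ((t\<^sup>2 - 1) * (t\<^sup>2 - 1)) =
      std_normal_density t * t ^ 4 - 2 * (std_normal_density t * t\<^sup>2) + std_normal_density t"
    for t :: real
    by (simp add: power2_eq_square power4_eq_xxxx algebra_simps)
  then show "has_bochner_integral lborel (\<lambda>t. std_normal_density t * ((t\<^sup>2 - 1) * (t\<^sup>2 - 1))) 2"
    using has_bochner_integral_add[OF has_bochner_integral_diff[OF m4
          has_bochner_integral_mult_right[OF m2, of 2]] m0] by simp
qed

text \<open>
  A function of one or two coordinates is a product over all coordinates whose other factors are the
  constant \<open>1\<close>, so \<open>gaussian_integral_prod\<close> applies to it. Off the diagonal a factor of mean zero
  remains; this is the orthogonality of distinct coordinates.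
\<close>
lemma gaussian_centred_square_covariances:
  assumes X: "spherical_gaussian M d X" and i: "i < d"
  shows "has_bochner_integral M (\<lambda>\<omega>. (X \<omega> i)\<^sup>2 - 1) 0"
    and "j < d \<Longrightarrow> has_bochner_integral M (\<lambda>\<omega>. ((X \<omega> i)\<^sup>2 - 1) * ((X \<omega> j)\<^sup>2 - 1))
           (if i = j then 2 else 0)"
proof -
  define q :: "nat \<Rightarrow> nat \<Rightarrow> real \<Rightarrow> real" where "q i k t = (if k = i then t\<^sup>2 - 1 else 1)" for i k t
  have [measurable]: "q i k \<in> borel_measurable borel" for i k
    unfolding q_def by measurable
  have q: "(\<Prod>k<d. q i k (x k)) = (x i)\<^sup>2 - 1" if "i < d" for i x
    using that by (simp add: q_def)
  have "has_bochner_integral M (\<lambda>\<omega>. \<Prod>k<d. q i k (X \<omega> k)) (\<Prod>k<d. if k = i then 0 else 1)"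
    using std_normal_centred_square_moments
    by (intro gaussian_integral_prod[OF X]) (auto simp: q_def)
  then show "has_bochner_integral M (\<lambda>\<omega>. (X \<omega> i)\<^sup>2 - 1) 0"
    using i by (simp add: q)
  assume j: "j < d"
  have "has_bochner_integral M (\<lambda>\<omega>. \<Prod>k<d. q i k (X \<omega> k) * q j k (X \<omega> k))
      (\<Prod>k<d. if k = i then (if i = j then 2 else 0) else if k = j then 0 else 1)"
    using std_normal_centred_square_moments
    by (intro gaussian_integral_prod[OF X]) (auto simp: q_def)
  moreover have "(\<Prod>k<d. if k = i then (if i = j then 2 else 0) else if k = j then 0 else 1)
      = (if i = j then 2 else 0 :: real)"
  proof (cases "i = j")
    case True
    have "(\<Prod>k<d. if k = i then (if i = j then 2 else 0) else if k = j then 0 else 1)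
        = (\<Prod>k<d. if k = i then 2 else 1 :: real)"
      using True by (intro prod.cong) auto
    then show ?thesis
      using True i by simp
  next
    case False
    then show ?thesis
      using i by (auto intro!: prod_zero)
  qed
  ultimately show "has_bochner_integral M (\<lambda>\<omega>. ((X \<omega> i)\<^sup>2 - 1) * ((X \<omega> j)\<^sup>2 - 1))
      (if i = j then 2 else 0)"
    using i j by (simp only: prod.distrib q)
qed

lemma gaussian_squared_norm_moments:
  assumes X: "spherical_gaussian M d X"
  shows "has_bochner_integral M (\<lambda>\<omega>. (norm_Rn d (X \<omega>))\<^sup>2 - real d) 0"
    and "has_bochner_integral M (\<lambda>\<omega>. ((norm_Rn d (X \<omega>))\<^sup>2 - real d)\<^sup>2) (2 * real d)"
proof -
  have S: "(norm_Rn d x)\<^sup>2 - real d = (\<Sum>i<d. (x i)\<^sup>2 - 1)" for x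
    by (simp add: norm_Rn_def L2_set_def sum_nonneg sum_subtractf)
  have "has_bochner_integral M (\<lambda>\<omega>. \<Sum>i<d. (X \<omega> i)\<^sup>2 - 1) (\<Sum>i<d. 0)"
    by (intro has_bochner_integral_sum gaussian_centred_square_covariances[OF X]) simp
  then show "has_bochner_integral M (\<lambda>\<omega>. (norm_Rn d (X \<omega>))\<^sup>2 - real d) 0"
    by (simp add: S)
  have "has_bochner_integral M (\<lambda>\<omega>. \<Sum>i<d. \<Sum>j<d. ((X \<omega> i)\<^sup>2 - 1) * ((X \<omega> j)\<^sup>2 - 1))
      (\<Sum>i<d. \<Sum>j<d. if i = j then 2 else 0)"
    by (intro has_bochner_integral_sum gaussian_centred_square_covariances[OF X]) simp_all
  then show "has_bochner_integral M (\<lambda>\<omega>. ((norm_Rn d (X \<omega>))\<^sup>2 - real d)\<^sup>2) (2 * real d)"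
    by (simp add: S power2_eq_square[of "sum _ _"] sum_product mult.commute)
qed

lemma norm_Rn_gaussian_measurable:
  assumes "spherical_gaussian M d X"
  shows "(\<lambda>\<omega>. norm_Rn d (X \<omega>)) \<in> borel_measurable M"
proof -
  have "X \<in> measurable M (lebesgue_Rn d)"
    using assms by (simp add: spherical_gaussian_def distributed_def)
  moreover have "norm_Rn d \<in> borel_measurable (lebesgue_Rn d)"
    unfolding norm_Rn_def L2_set_def lebesgue_Rn_def by measurable
  ultimately show ?thesis
    by (rule measurable_compose)
qed

section \<open>The norm of a spherical Gaussian vector\<close>

theorem theorem1p2:
  fixes M :: "nat \<Rightarrow> 'a measure"
    and X :: "nat \<Rightarrow> 'a \<Rightarrow> nat \<Rightarrow> real"
  assumes "\<And>d. d \<ge> 1 \<Longrightarrow> prob_space (M d)"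
    and "\<And>d. d \<ge> 1 \<Longrightarrow> spherical_gaussian (M d) d (X d)"
  shows "(\<forall>d\<ge>1.
            integrable (M d) (\<lambda>\<omega>. norm_Rn d (X d \<omega>) - sqrt (real d)) \<and>
            \<bar>prob_space.expectation (M d) (\<lambda>\<omega>. norm_Rn d (X d \<omega>) - sqrt (real d))\<bar>
              \<le> 1 / sqrt (real d))
       \<and> (\<forall>d\<ge>1.
            integrable (M d) (\<lambda>\<omega>. (norm_Rn d (X d \<omega>)
              - prob_space.expectation (M d) (\<lambda>\<omega>. norm_Rn d (X d \<omega>)))\<^sup>2) \<and>
            prob_space.variance (M d) (\<lambda>\<omega>. norm_Rn d (X d \<omega>)) \<le> 2)
       \<and> (\<lambda>d. prob_space.expectation (M d) (\<lambda>\<omega>. norm_Rn d (X d \<omega>) - sqrt (real d)))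
            \<longlonglongrightarrow> 0"
proof -
  let ?N = "\<lambda>d \<omega>. norm_Rn d (X d \<omega>)"
  let ?E = "\<lambda>d. prob_space.expectation (M d) (\<lambda>\<omega>. ?N d \<omega> - sqrt (real d))"
  have bounds: "integrable (M d) (\<lambda>\<omega>. ?N d \<omega> - sqrt (real d)) \<and> \<bar>?E d\<bar> \<le> 1 / sqrt (real d) \<and>
      integrable (M d) (\<lambda>\<omega>. (?N d \<omega> - prob_space.expectation (M d) (?N d))\<^sup>2) \<and>
      prob_space.variance (M d) (?N d) \<le> 2" if d: "d \<ge> 1" for d
  proof -
    interpret prob_space "M d"
      using assms(1)[OF d] .
    note X = assms(2)[OF d]
    have nonneg: "0 \<le> ?N d \<omega>" for \<omega>
      by (simp add: norm_Rn_def L2_set_def sum_nonneg)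
    have c: "0 < sqrt (real d)"
      using d by simp
    have c2: "(sqrt (real d))\<^sup>2 = real d"
      by simp
    have c3: "2 * real d / (2 * sqrt (real d) ^ 3) = 1 / sqrt (real d)"
      using d by (simp add: power3_eq_cube)
    have c4: "2 * real d / real d = 2"
      using d by simp
    note root = mean_and_variance_of_root[OF norm_Rn_gaussian_measurable[OF X] nonneg c,
        unfolded c2, OF gaussian_squared_norm_moments[OF X], unfolded c3 c4]
    show ?thesis
      using root by simp
  qed
  have "?E \<longlonglongrightarrow> 0"
  proof (rule Lim_null_comparison)
    show "eventually (\<lambda>d. norm (?E d) \<le> 1 / sqrt (real d)) sequentially"
      using bounds by (auto intro!: eventually_sequentiallyI[of 1])
    show "(\<lambda>d. 1 / sqrt (real d)) \<longlonglongrightarrow> 0"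
      by (intro tendsto_divide_0[OF tendsto_const] filterlim_at_top_imp_at_infinity
          filterlim_compose[OF sqrt_at_top filterlim_real_sequentially])
  qed
  with bounds show ?thesis
    by blast
qed

end
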